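(* Let $\mathcal{M}=\mathcal{SE}_2(3)\times\mathbb{R}^6$ with elements $\xi=(\mathbf{T},\boldsymbol{b})$, and let $\mathbf{G_{SD}}=\mathbf{SE}_2(3)\ltimes\mathfrak{se}(3)$ with elements $X=(D,\delta)$, where $D=(A,a,b)\in\mathbf{SE}_2(3)$, $A\in\mathbf{SO}(3)$, $a,b\in\mathbb{R}^3$, $\delta\in\mathfrak{se}(3)$, and set $B=(A,a)\in\mathbf{HG}(3)$. Define $\phi:\mathbf{G_{SD}}\times\mathcal{M}\to\mathcal{M}$ by $$\phi(X,\xi):=\big(\mathbf{T}D,\;\mathbf{Ad}^{\vee}_{B^{-1}}(\boldsymbol{b}-\delta^{\vee})\big).$$ Then $\phi$ is a transitive right group action of $\mathbf{G_{SD}}$ on $\mathcal{M}$.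
   Context: $\mathbf{SE}_2(3)$ is the matrix Lie group of $5\times5$ matrices $D=(A,a,b)=\begin{bmatrix}A&a&b\\0&1&0\\0&0&1\end{bmatrix}$ with $A\in\mathbf{SO}(3)$, $a,b\in\mathbb{R}^3$; $\mathcal{SE}_2(3)$ is its underlying smooth manifold. $\mathbf{HG}(3)\cong\mathbf{SE}(3)$ is the group of $4\times4$ matrices $B=(A,a)=\begin{bmatrix}A&a\\0&1\end{bmatrix}$; so $B$ is the upper-left $4\times4$ block of $D$. The Lie algebra $\mathfrak{se}(3)$ consists of the matrices $(\boldsymbol{\omega},\boldsymbol{v})^{\wedge}=\begin{bmatrix}\boldsymbol{\omega}^{\wedge}&\boldsymbol{v}\\0&0\end{bmatrix}$, with $\boldsymbol{\omega}^{\wedge}$ the $3\times3$ skew-symmetric cross-product matrix; $(\cdot)^{\vee}:\mathfrak{se}(3)\to\mathbb{R}^6$ is the inverse of $(\cdot)^{\wedge}$. $\mathrm{Ad}_B[\eta]=B\eta B^{-1}$ and $\mathbf{Ad}^{\vee}_B\boldsymbol{u}=(\mathrm{Ad}_B[\boldsymbol{u}^{\wedge}])^{\vee}$ for $\boldsymbol{u}\in\mathbb{R}^6$. The group product in $\mathbf{G_{SD}}$ is $XY=(D_XD_Y,\;\delta_X+\mathrm{Ad}_{B_X}[\delta_Y])$, with inverse $X^{-1}=(D^{-1},-\mathrm{Ad}_{B^{-1}}[\delta])$. A right group action is a smooth map with $\phi(I,\xi)=\xi$ and $\phi(X,\phi(Y,\xi))=\phi(YX,\xi)$; it is transitive if for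 all $\xi_1,\xi_2\in\mathcal{M}$ there is $Z$ with $\phi(Z,\xi_1)=\xi_2$. *)

theory Defs
  imports "HOL-Analysis.Analysis" "HOL-Algebra.Group"
begin

text \<open>
  Meant for open \<open>U\<close>, where it is the usual class of \<open>k\<close> times continuously differentiable
  functions: all iterated directional derivatives up to order \<open>k\<close> exist and are continuous.
\<close>

primrec Ck_on :: "nat \<Rightarrow> 'a::euclidean_space set \<Rightarrow> ('a \<Rightarrow> 'b::euclidean_space) \<Rightarrow> bool" where
  "Ck_on 0 U f \<longleftrightarrow> continuous_on U f"
| "Ck_on (Suc k) U f \<longleftrightarrow>
     (\<forall>x\<in>U. f differentiable (at x)) \<and>
     (\<forall>v. Ck_on k U (\<lambda>x. frechet_derivative f (at x) v))"

text \<open>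
  For embedded submanifolds \<open>S\<close> and \<open>T\<close> of Euclidean spaces, smoothness in charts is the same
  as local extendability to a smooth map on an open subset of the ambient space.
\<close>

definition smooth_map ::
    "'a::euclidean_space set \<Rightarrow> 'b::euclidean_space set \<Rightarrow> ('a \<Rightarrow> 'b) \<Rightarrow> bool" where
  "smooth_map S T f \<longleftrightarrow> f \<in> S \<rightarrow> T \<and>
     (\<forall>x\<in>S. \<exists>U g. open U \<and> x \<in> U \<and> (\<forall>k. Ck_on k U g) \<and> (\<forall>y\<in>S \<inter> U. g y = f y))"

definition right_group_action ::
    "('g::euclidean_space, 'r) monoid_scheme \<Rightarrow> 'm::euclidean_space set \<Rightarrow>
     ('g \<Rightarrow> 'm \<Rightarrow> 'm) \<Rightarrow> bool" where
  "right_group_action G M \<phi> \<longleftrightarrow>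
     group G \<and>
     smooth_map (carrier G \<times> M) M (\<lambda>(X, \<xi>). \<phi> X \<xi>) \<and>
     (\<forall>\<xi>\<in>M. \<phi> \<one>\<^bsub>G\<^esub> \<xi> = \<xi>) \<and>
     (\<forall>X\<in>carrier G. \<forall>Y\<in>carrier G. \<forall>\<xi>\<in>M. \<phi> X (\<phi> Y \<xi>) = \<phi> (Y \<otimes>\<^bsub>G\<^esub> X) \<xi>)"

definition transitive_action ::
    "('g, 'r) monoid_scheme \<Rightarrow> 'm set \<Rightarrow> ('g \<Rightarrow> 'm \<Rightarrow> 'm) \<Rightarrow> bool" where
  "transitive_action G M \<phi> \<longleftrightarrow> (\<forall>\<xi>\<^sub>1\<in>M. \<forall>\<xi>\<^sub>2\<in>M. \<exists>Z\<in>carrier G. \<phi> Z \<xi>\<^sub>1 = \<xi>\<^sub>2)"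

text \<open>
  The numeral types \<open>4\<close>, \<open>5\<close>, \<open>6\<close> are indexed from \<open>1\<close> as in the library lemmas for dimension 3;
  the last index coincides with \<open>0\<close>.
\<close>

definition SO3 :: "(real^3^3) set" where
  "SO3 = {A. rotation_matrix A}"

definition se23_mat :: "real^3^3 \<Rightarrow> real^3 \<Rightarrow> real^3 \<Rightarrow> real^5^5" where
  "se23_mat A a b = vector
     [vector [A$1$1, A$1$2, A$1$3, a$1, b$1],
      vector [A$2$1, A$2$2, A$2$3, a$2, b$2],
      vector [A$3$1, A$3$2, A$3$3, a$3, b$3],
      vector [0, 0, 0, 1, 0],
      vector [0, 0, 0, 0, 1]]"

definition SE23 :: "(real^5^5) set" where
  "SE23 = {se23_mat A a b | A a b. A \<in> SO3}"

definition hg_mat :: "real^3^3 \<Rightarrow> real^3 \<Rightarrow> real^4^4" where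
  "hg_mat A a = vector
     [vector [A$1$1, A$1$2, A$1$3, a$1],
      vector [A$2$1, A$2$2, A$2$3, a$2],
      vector [A$3$1, A$3$2, A$3$3, a$3],
      vector [0, 0, 0, 1]]"

definition HG3 :: "(real^4^4) set" where
  "HG3 = {hg_mat A a | A a. A \<in> SO3}"

text \<open>The upper-left $4\times 4$ block, i.e.\ the passage from $D=(A,a,b)$ to $B=(A,a)$.\<close>

definition hg_block :: "real^5^5 \<Rightarrow> real^4^4" where
  "hg_block D = vector
     [vector [D$1$1, D$1$2, D$1$3, D$1$4],
      vector [D$2$1, D$2$2, D$2$3, D$2$4],
      vector [D$3$1, D$3$2, D$3$3, D$3$4],
      vector [D$4$1, D$4$2, D$4$3, D$4$4]]"

definition wedge3 :: "real^3 \<Rightarrow> real^3^3" where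
  "wedge3 w = vector
     [vector [0, - w$3, w$2],
      vector [w$3, 0, - w$1],
      vector [- w$2, w$1, 0]]"

text \<open>A vector of $\mathbb{R}^6$ is read as $(\omega, v)$, with $\omega$ in the first three entries.\<close>

definition wedge :: "real^6 \<Rightarrow> real^4^4" where
  "wedge u =
     (let W = wedge3 (vector [u$1, u$2, u$3]) in vector
     [vector [W$1$1, W$1$2, W$1$3, u$4],
      vector [W$2$1, W$2$2, W$2$3, u$5],
      vector [W$3$1, W$3$2, W$3$3, u$6],
      vector [0, 0, 0, 0]])"

definition se3 :: "(real^4^4) set" where
  "se3 = range wedge"

definition vee :: "real^4^4 \<Rightarrow> real^6" where
  "vee = the_inv wedge"

definition Ad :: "real^4^4 \<Rightarrow> real^4^4 \<Rightarrow> real^4^4" where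
  "Ad B \<eta> = B ** \<eta> ** matrix_inv B"

definition Ad_vee :: "real^4^4 \<Rightarrow> real^6 \<Rightarrow> real^6" where
  "Ad_vee B u = vee (Ad B (wedge u))"

definition G_SD :: "((real^5^5) \<times> (real^4^4)) monoid" where
  "G_SD = \<lparr>carrier = SE23 \<times> se3,
     mult = (\<lambda>(D\<^sub>X, \<delta>\<^sub>X) (D\<^sub>Y, \<delta>\<^sub>Y). (D\<^sub>X ** D\<^sub>Y, \<delta>\<^sub>X + Ad (hg_block D\<^sub>X) \<delta>\<^sub>Y)),
     one = (mat 1, 0)\<rparr>"

definition M_SD :: "((real^5^5) \<times> (real^6)) set" where
  "M_SD = SE23 \<times> UNIV"

definition phi_SD :: "(real^5^5) \<times> (real^4^4) \<Rightarrow> (real^5^5) \<times> (real^6) \<Rightarrow> (real^5^5) \<times> (real^6)" where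
  "phi_SD = (\<lambda>(D, \<delta>) (T, b). (T ** D, Ad_vee (matrix_inv (hg_block D)) (b - vee \<delta>)))"

lemma vector_4_nth [simp]:
  "(vector [x1,x2,x3,x4] :: 'a::zero^4) $ 1 = x1"
  "(vector [x1,x2,x3,x4] :: 'a::zero^4) $ 2 = x2"
  "(vector [x1,x2,x3,x4] :: 'a::zero^4) $ 3 = x3"
  "(vector [x1,x2,x3,x4] :: 'a::zero^4) $ 4 = x4"
  by (simp_all add: vector_def)

lemma vector_5_nth [simp]:
  "(vector [x1,x2,x3,x4,x5] :: 'a::zero^5) $ 1 = x1"
  "(vector [x1,x2,x3,x4,x5] :: 'a::zero^5) $ 2 = x2"
  "(vector [x1,x2,x3,x4,x5] :: 'a::zero^5) $ 3 = x3"
  "(vector [x1,x2,x3,x4,x5] :: 'a::zero^5) $ 4 = x4"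
  "(vector [x1,x2,x3,x4,x5] :: 'a::zero^5) $ 5 = x5"
  by (simp_all add: vector_def)

lemma vector_6_nth [simp]:
  "(vector [x1,x2,x3,x4,x5,x6] :: 'a::zero^6) $ 1 = x1"
  "(vector [x1,x2,x3,x4,x5,x6] :: 'a::zero^6) $ 2 = x2"
  "(vector [x1,x2,x3,x4,x5,x6] :: 'a::zero^6) $ 3 = x3"
  "(vector [x1,x2,x3,x4,x5,x6] :: 'a::zero^6) $ 4 = x4"
  "(vector [x1,x2,x3,x4,x5,x6] :: 'a::zero^6) $ 5 = x5"
  "(vector [x1,x2,x3,x4,x5,x6] :: 'a::zero^6) $ 6 = x6"
  by (simp_all add: vector_def)

lemma exhaust_5:
  fixes x :: 5
  shows "x = 1 \<or> x = 2 \<or> x = 3 \<or> x = 4 \<or> x = 5"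
proof (induct x)
  case (of_int z)
  then have "z = 0 \<or> z = 1 \<or> z = 2 \<or> z = 3 \<or> z = 4" by (simp, arith)
  then show ?case by auto
qed

lemma exhaust_6:
  fixes x :: 6
  shows "x = 1 \<or> x = 2 \<or> x = 3 \<or> x = 4 \<or> x = 5 \<or> x = 6"
proof (induct x)
  case (of_int z)
  then have "z = 0 \<or> z = 1 \<or> z = 2 \<or> z = 3 \<or> z = 4 \<or> z = 5" by (simp, arith)
  then show ?case by auto
qed

lemma forall_5: "(\<forall>i::5. P i) \<longleftrightarrow> P 1 \<and> P 2 \<and> P 3 \<and> P 4 \<and> P 5"
  by (metis exhaust_5)

lemma forall_6: "(\<forall>i::6. P i) \<longleftrightarrow> P 1 \<and> P 2 \<and> P 3 \<and> P 4 \<and> P 5 \<and> P 6"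
  by (metis exhaust_6)

lemma sum_5: "sum f (UNIV::5 set) = f 1 + f 2 + f 3 + f 4 + f 5"
proof -
  have "UNIV = {1, 2, 3, 4, 5::5}" using exhaust_5 by auto
  then have "sum f UNIV = sum f {1, 2, 3, 4, 5::5}" by (rule arg_cong)
  then show ?thesis by (simp add: ac_simps)
qed

lemma wedge3_mult_vector: "wedge3 w *v x = cross3 w x"
  by (simp add: vec_eq_iff forall_3 wedge3_def cross3_def matrix_vector_mult_def sum_3)

lemma hg_block_se23_mat: "hg_block (se23_mat A a b) = hg_mat A a"
  by (simp add: vec_eq_iff forall_4 hg_block_def se23_mat_def hg_mat_def)

lemma inj_wedge: "inj wedge"
  by (rule injI) (simp add: vec_eq_iff forall_4 forall_6 wedge_def wedge3_def Let_def)

lemma vee_wedge [simp]: "vee (wedge u) = u"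
  by (simp add: vee_def the_inv_f_f inj_wedge)

lemma wedge_vee: "\<eta> \<in> se3 \<Longrightarrow> wedge (vee \<eta>) = \<eta>"
  by (auto simp: se3_def)

lemma se23_mat_mult:
  "se23_mat A a b ** se23_mat A' a' b' = se23_mat (A ** A') (A *v a' + a) (A *v b' + b)"
  by (simp add: vec_eq_iff forall_5 forall_3 se23_mat_def matrix_matrix_mult_def
      matrix_vector_mult_def sum_5 sum_3)

lemma hg_mat_mult: "hg_mat A a ** hg_mat A' a' = hg_mat (A ** A') (A *v a' + a)"
  by (simp add: vec_eq_iff forall_4 forall_3 hg_mat_def matrix_matrix_mult_def
      matrix_vector_mult_def sum_4 sum_3)

lemma se23_mat_1: "se23_mat (mat 1) 0 0 = mat 1"
  by (simp add: vec_eq_iff forall_5 se23_mat_def mat_def)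

lemma hg_mat_1: "hg_mat (mat 1) 0 = mat 1"
  by (simp add: vec_eq_iff forall_4 hg_mat_def mat_def)

lemma SO3_1: "mat 1 \<in> SO3"
  by (simp add: SO3_def rotation_matrix_def orthogonal_matrix_id)

lemma SO3_mult: "A \<in> SO3 \<Longrightarrow> A' \<in> SO3 \<Longrightarrow> A ** A' \<in> SO3"
  by (simp add: SO3_def rotation_matrix_def orthogonal_matrix_mul det_mul)

lemma SO3_transpose: "A \<in> SO3 \<Longrightarrow> transpose A \<in> SO3"
  by (simp add: SO3_def rotation_matrix_def orthogonal_matrix_transpose)

lemma SO3_D: "A \<in> SO3 \<Longrightarrow> transpose A ** A = mat 1" "A \<in> SO3 \<Longrightarrow> A ** transpose A = mat 1"
  by (simp_all add: SO3_def rotation_matrix_def orthogonal_matrix_def)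

lemma matrix_inv_eqI:
  fixes A :: "real^'n^'n"
  assumes "A ** B = mat 1"
  shows "matrix_inv A = B"
proof -
  have "\<exists>A'. A ** A' = mat 1 \<and> A' ** A = mat 1"
    using assms matrix_left_right_inverse by blast
  then have "matrix_inv A ** A = mat 1"
    unfolding matrix_inv_def by (rule someI2_ex) simp
  then show ?thesis
    by (metis assms matrix_mul_assoc matrix_mul_lid matrix_mul_rid)
qed

lemma hg_mat_mult_inv:
  assumes "A \<in> SO3"
  shows "hg_mat A a ** hg_mat (transpose A) (- (transpose A *v a)) = mat 1"
proof -
  have "A *v (- (transpose A *v a)) = - (A *v (transpose A *v a))"
    by (simp add: vec_eq_iff matrix_vector_mult_def sum_negf)
  also have "\<dots> = - a"
    by (simp only: matrix_vector_mul_assoc SO3_D(2)[OF assms] matrix_vector_mul_lid)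
  finally show ?thesis
    by (simp add: hg_mat_mult SO3_D(2)[OF assms] hg_mat_1 del: transpose_matrix_vector)
qed

lemma matrix_inv_hg_mat:
  "A \<in> SO3 \<Longrightarrow> matrix_inv (hg_mat A a) = hg_mat (transpose A) (- (transpose A *v a))"
  by (rule matrix_inv_eqI[OF hg_mat_mult_inv])

lemma HG3_closed:
  assumes "B \<in> HG3"
  shows HG3_matrix_inv: "matrix_inv B \<in> HG3"
    and HG3_right_inv: "B ** matrix_inv B = mat 1"
    and HG3_left_inv: "matrix_inv B ** B = mat 1"
proof -
  obtain A a where B: "B = hg_mat A a" "A \<in> SO3"
    using assms by (auto simp: HG3_def)
  show "matrix_inv B \<in> HG3"
    using B SO3_transpose by (auto simp: HG3_def matrix_inv_hg_mat)
  show r: "B ** matrix_inv B = mat 1"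
    using B by (simp only: matrix_inv_hg_mat hg_mat_mult_inv)
  then show "matrix_inv B ** B = mat 1"
    using matrix_left_right_inverse by blast
qed

lemma HG3_matrix_inv_mult:
  assumes "B \<in> HG3" "C \<in> HG3"
  shows "matrix_inv (B ** C) = matrix_inv C ** matrix_inv B"
proof (rule matrix_inv_eqI)
  have "B ** C ** (matrix_inv C ** matrix_inv B) = B ** (C ** matrix_inv C) ** matrix_inv B"
    by (simp add: matrix_mul_assoc)
  then show "B ** C ** (matrix_inv C ** matrix_inv B) = mat 1"
    using assms by (simp add: HG3_right_inv)
qed

lemma se3_iff:
  "\<eta> \<in> se3 \<longleftrightarrow> \<eta>$1$1 = 0 \<and> \<eta>$2$2 = 0 \<and> \<eta>$3$3 = 0 \<and> \<eta>$1$2 = - \<eta>$2$1 \<and>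
     \<eta>$1$3 = - \<eta>$3$1 \<and> \<eta>$2$3 = - \<eta>$3$2 \<and> \<eta>$4 = 0"
proof
  assume "\<eta> \<in> se3"
  then show "\<eta>$1$1 = 0 \<and> \<eta>$2$2 = 0 \<and> \<eta>$3$3 = 0 \<and> \<eta>$1$2 = - \<eta>$2$1 \<and>
     \<eta>$1$3 = - \<eta>$3$1 \<and> \<eta>$2$3 = - \<eta>$3$2 \<and> \<eta>$4 = 0"
    by (auto simp: se3_def wedge_def wedge3_def Let_def vec_eq_iff forall_4)
next
  assume *: "\<eta>$1$1 = 0 \<and> \<eta>$2$2 = 0 \<and> \<eta>$3$3 = 0 \<and> \<eta>$1$2 = - \<eta>$2$1 \<and>
     \<eta>$1$3 = - \<eta>$3$1 \<and> \<eta>$2$3 = - \<eta>$3$2 \<and> \<eta>$4 = 0"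
  have "\<eta> = wedge (vector [\<eta>$3$2, \<eta>$1$3, \<eta>$2$1, \<eta>$1$4, \<eta>$2$4, \<eta>$3$4])"
    using * by (simp add: wedge_def wedge3_def Let_def vec_eq_iff forall_4)
  then show "\<eta> \<in> se3" unfolding se3_def by blast
qed

lemma se3_0: "0 \<in> se3"
  and se3_add: "\<eta> \<in> se3 \<Longrightarrow> \<theta> \<in> se3 \<Longrightarrow> \<eta> + \<theta> \<in> se3"
  and se3_uminus: "\<eta> \<in> se3 \<Longrightarrow> - \<eta> \<in> se3"
  by (simp_all add: se3_iff)

lemma Ad_se3:
  assumes "B \<in> HG3" "\<eta> \<in> se3"
  shows "Ad B \<eta> \<in> se3"
proof -
  obtain A a where B: "B = hg_mat A a" "A \<in> SO3"
    using assms by (auto simp: HG3_def)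
  show ?thesis
    using assms(2) unfolding B(1) Ad_def matrix_inv_hg_mat[OF B(2)] se3_iff
    by (simp add: vec_eq_iff forall_4 matrix_matrix_mult_def sum_4 hg_mat_def transpose_def
        algebra_simps)
qed

lemma Ad_mat_1: "Ad (mat 1) \<eta> = \<eta>"
  by (simp add: Ad_def matrix_inv_eqI)

lemma Ad_mult: "B \<in> HG3 \<Longrightarrow> C \<in> HG3 \<Longrightarrow> Ad (B ** C) \<eta> = Ad B (Ad C \<eta>)"
  by (simp add: Ad_def HG3_matrix_inv_mult matrix_mul_assoc)

lemma Ad_add: "Ad B (\<eta> + \<theta>) = Ad B \<eta> + Ad B \<theta>"
  by (simp add: Ad_def matrix_matrix_mult_def vec_eq_iff sum.distrib algebra_simps)

lemma Ad_uminus: "Ad B (- \<eta>) = - Ad B \<eta>"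
  by (metis Ad_add add.right_inverse add_cancel_right_right add_eq_0_iff)

lemma hg_block_HG3: "D \<in> SE23 \<Longrightarrow> hg_block D \<in> HG3"
  unfolding SE23_def HG3_def by (force simp: hg_block_se23_mat)

lemma hg_block_mult:
  "D \<in> SE23 \<Longrightarrow> E \<in> SE23 \<Longrightarrow> hg_block (D ** E) = hg_block D ** hg_block E"
  by (auto simp: SE23_def se23_mat_mult hg_block_se23_mat hg_mat_mult)

lemma hg_block_1: "hg_block (mat 1) = mat 1"
  by (metis hg_block_se23_mat hg_mat_1 se23_mat_1)

lemma SE23_1: "mat 1 \<in> SE23"
  unfolding SE23_def using SO3_1 se23_mat_1 by (metis (mono_tags, lifting) mem_Collect_eq)

lemma SE23_mult: "D \<in> SE23 \<Longrightarrow> E \<in> SE23 \<Longrightarrow> D ** E \<in> SE23"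
  unfolding SE23_def using se23_mat_mult SO3_mult by (smt (verit) mem_Collect_eq)

lemma SE23_closed:
  assumes "D \<in> SE23"
  shows SE23_matrix_inv: "matrix_inv D \<in> SE23"
    and SE23_right_inv: "D ** matrix_inv D = mat 1"
    and SE23_left_inv: "matrix_inv D ** D = mat 1"
proof -
  obtain A a b where D: "D = se23_mat A a b" "A \<in> SO3"
    using assms by (auto simp: SE23_def)
  let ?E = "se23_mat (transpose A) (- (transpose A *v a)) (- (transpose A *v b))"
  have neg: "A *v (- (transpose A *v x)) = - x" for x
  proof -
    have "A *v (- (transpose A *v x)) = - (A *v (transpose A *v x))"
      by (simp add: vec_eq_iff matrix_vector_mult_def sum_negf)
    then show ?thesis
      by (simp only: matrix_vector_mul_assoc SO3_D(2)[OF D(2)] matrix_vector_mul_lid)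
  qed
  have DE: "D ** ?E = mat 1"
    by (simp add: D(1) se23_mat_mult neg SO3_D(2)[OF D(2)] se23_mat_1 del: transpose_matrix_vector)
  then have inv: "matrix_inv D = ?E"
    by (rule matrix_inv_eqI)
  show "matrix_inv D \<in> SE23"
    unfolding inv using SO3_transpose[OF D(2)] by (auto simp: SE23_def)
  show "D ** matrix_inv D = mat 1"
    unfolding inv by (rule DE)
  then show "matrix_inv D ** D = mat 1"
    using matrix_left_right_inverse by blast
qed

lemma group_G_SD: "group G_SD"
proof (rule groupI)
  fix X Y Z
  assume "X \<in> carrier G_SD" "Y \<in> carrier G_SD" "Z \<in> carrier G_SD"
  then show "X \<otimes>\<^bsub>G_SD\<^esub> Y \<otimes>\<^bsub>G_SD\<^esub> Z = X \<otimes>\<^bsub>G_SD\<^esub> (Y \<otimes>\<^bsub>G_SD\<^esub> Z)"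
    by (auto simp: G_SD_def matrix_mul_assoc hg_block_mult hg_block_HG3 Ad_mult Ad_add)
next
  fix X assume "X \<in> carrier G_SD"
  then obtain D \<delta> where X: "X = (D, \<delta>)" "D \<in> SE23" "\<delta> \<in> se3"
    by (auto simp: G_SD_def)
  let ?Y = "(matrix_inv D, - Ad (hg_block (matrix_inv D)) \<delta>)"
  have "?Y \<in> carrier G_SD"
    using X by (simp add: G_SD_def SE23_matrix_inv se3_uminus Ad_se3 hg_block_HG3)
  moreover have "?Y \<otimes>\<^bsub>G_SD\<^esub> X = \<one>\<^bsub>G_SD\<^esub>"
    using X by (simp add: G_SD_def SE23_left_inv)
  ultimately show "\<exists>Y\<in>carrier G_SD. Y \<otimes>\<^bsub>G_SD\<^esub> X = \<one>\<^bsub>G_SD\<^esub>" by blast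
qed (auto simp: G_SD_def SE23_mult SE23_1 se3_0 se3_add Ad_se3 hg_block_HG3 hg_block_1 Ad_mat_1)

lemma hg_block_matrix_inv:
  assumes "D \<in> SE23"
  shows "hg_block (matrix_inv D) = matrix_inv (hg_block D)"
proof (rule matrix_inv_eqI[symmetric])
  show "hg_block D ** hg_block (matrix_inv D) = mat 1"
    using assms hg_block_mult[of D "matrix_inv D"]
    by (simp add: SE23_matrix_inv SE23_right_inv hg_block_1)
qed

lemma inv_G_SD:
  assumes "D \<in> SE23" "\<delta> \<in> se3"
  shows "inv\<^bsub>G_SD\<^esub> (D, \<delta>) = (matrix_inv D, - Ad (matrix_inv (hg_block D)) \<delta>)"
proof -
  interpret group G_SD by (rule group_G_SD)
  show ?thesis
  proof (rule inv_equality)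
    show "(matrix_inv D, - Ad (matrix_inv (hg_block D)) \<delta>) \<otimes>\<^bsub>G_SD\<^esub> (D, \<delta>) = \<one>\<^bsub>G_SD\<^esub>"
      using assms by (simp add: G_SD_def SE23_left_inv hg_block_matrix_inv)
  qed (use assms in \<open>simp_all add: G_SD_def SE23_matrix_inv se3_uminus Ad_se3 HG3_matrix_inv hg_block_HG3\<close>)
qed

end

theory Submission
  imports Defs
begin

text \<open>
  Transporting the second component along \<open>wedge\<close> turns the action into
  \<open>\<eta> \<mapsto> Ad B\<inverse> (\<eta> - \<delta>)\<close>, so the action law is the semidirect product formula, and
  \<open>(T\<^sub>1\<inverse> T\<^sub>2, \<eta>\<^sub>1 - Ad B \<eta>\<^sub>2)\<close> moves \<open>(T\<^sub>1, \<eta>\<^sub>1)\<close> to \<open>(T\<^sub>2, \<eta>\<^sub>2)\<close>. For smoothness, note that on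
  rotations the inverse is the transpose; hence \<open>B\<inverse>\<close>, and with it the whole action, is the
  restriction of a map that is polynomial in the matrix entries.
\<close>

section \<open>Closure properties of \<open>C\<^sup>k\<close> functions\<close>

lemma Ck_on_imp_continuous_on: "Ck_on k U f \<Longrightarrow> continuous_on U f"
  by (cases k)
     (auto intro!: continuous_at_imp_continuous_on differentiable_imp_continuous_within)

text \<open>Differentiability gives continuity at the bottom; above it, the claim passes to the
  directional derivatives by induction.\<close>

lemma Ck_on_SucD: "Ck_on (Suc k) U f \<Longrightarrow> Ck_on k U f"
proof (induction k arbitrary: f)
  case 0
  then show ?case
    using Ck_on_imp_continuous_on[OF 0] by simp
next
  case (Suc k)
  then show ?case by (metis Ck_on.simps(2))
qed

text \<open>Openness of \<open>U\<close> is essential: \<open>frechet_derivative\<close> looks at a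
  full neighbourhood, so agreement on \<open>U\<close> transfers to derivatives only at interior
  points.\<close>

lemma Ck_on_cong:
  assumes "open U" "\<And>x. x \<in> U \<Longrightarrow> f x = g x" "Ck_on k U f"
  shows "Ck_on k U g"
  using assms(2,3)
proof (induction k arbitrary: f g)
  case 0
  then show ?case by (simp cong: continuous_on_cong)
next
  case (Suc k)
  have der: "(g has_derivative frechet_derivative f (at x)) (at x)" if "x \<in> U" for x
  proof -
    have "(f has_derivative frechet_derivative f (at x)) (at x)"
      using Suc.prems(2) that by (simp add: frechet_derivative_works)
    then show ?thesis
      by (rule has_derivative_transform_within_open[OF _ assms(1) that]) (simp add: Suc.prems(1))
  qed
  have "Ck_on k U (\<lambda>x. frechet_derivative g (at x) v)" for v
  proof (rule Suc.IH)
    show "Ck_on k U (\<lambda>x. frechet_derivative f (at x) v)"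
      using Suc.prems(2) by simp
  qed (simp add: frechet_derivative_at[OF der, symmetric])
  then show ?case
    using der by (auto simp: differentiable_def)
qed

text \<open>Derivatives are unique, so the chosen \<open>frechet_derivative\<close> may be replaced
  by any explicit derivative. The closure proofs below can thus use the standard differentiation
  rules.\<close>

lemma Ck_on_SucI:
  assumes "open U"
    and der: "\<And>x. x \<in> U \<Longrightarrow> (f has_derivative f' x) (at x)"
    and Ck: "\<And>v. Ck_on k U (\<lambda>x. f' x v)"
  shows "Ck_on (Suc k) U f"
proof -
  have "Ck_on k U (\<lambda>x. frechet_derivative f (at x) v)" for v
    by (rule Ck_on_cong[OF assms(1) _ Ck]) (simp add: frechet_derivative_at[OF der, symmetric])
  then show ?thesis
    using der by (auto simp: differentiable_def)
qed

lemma Ck_on_SucE: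
  assumes "Ck_on (Suc k) U f"
  shows "x \<in> U \<Longrightarrow> (f has_derivative frechet_derivative f (at x)) (at x)"
    and "Ck_on k U (\<lambda>x. frechet_derivative f (at x) v)"
  using assms by (simp_all add: frechet_derivative_works)

lemma Ck_on_const: "open U \<Longrightarrow> Ck_on k U (\<lambda>x. c)"
proof (induction k arbitrary: c)
  case (Suc k)
  show ?case by (rule Ck_on_SucI[OF Suc.prems has_derivative_const]) (rule Suc.IH[OF Suc.prems])
qed simp

text \<open>A linear map is its own derivative at every point, so its directional derivatives are
  constant and no induction arises.\<close>

lemma Ck_on_bounded_linear:
  assumes "open U" "bounded_linear f"
  shows "Ck_on k U f"
proof (cases k)
  case 0
  then show ?thesis using assms(2) by (simp add: linear_continuous_on)
next
  case (Suc j)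
  show ?thesis unfolding Suc
    by (rule Ck_on_SucI[OF assms(1) bounded_linear_imp_has_derivative[OF assms(2)]])
       (rule Ck_on_const[OF assms(1)])
qed

lemma Ck_on_bounded_linear_compose:
  assumes "open U" "bounded_linear h" "Ck_on k U f"
  shows "Ck_on k U (\<lambda>x. h (f x))"
  using assms(3)
proof (induction k arbitrary: f)
  case 0
  then show ?case using assms(2) by (simp add: bounded_linear.continuous_on)
next
  case (Suc k)
  show ?case
    by (rule Ck_on_SucI[OF assms(1) bounded_linear.has_derivative[OF assms(2)]])
       (auto intro!: Suc.IH intro: Ck_on_SucE[OF Suc.prems])
qed

lemma Ck_on_add:
  assumes "open U" "Ck_on k U f" "Ck_on k U g"
  shows "Ck_on k U (\<lambda>x. f x + g x)"
  using assms(2,3)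
proof (induction k arbitrary: f g)
  case 0
  then show ?case by (simp add: continuous_on_add)
next
  case (Suc k)
  show ?case
    by (rule Ck_on_SucI[OF assms(1) has_derivative_add])
       (auto intro!: Suc.IH intro: Ck_on_SucE[OF Suc.prems(1)] Ck_on_SucE[OF Suc.prems(2)])
qed

lemma Ck_on_uminus: "open U \<Longrightarrow> Ck_on k U f \<Longrightarrow> Ck_on k U (\<lambda>x. - f x)"
  by (rule Ck_on_bounded_linear_compose[OF _ bounded_linear_minus[OF bounded_linear_ident]])

lemma Ck_on_diff: "open U \<Longrightarrow> Ck_on k U f \<Longrightarrow> Ck_on k U g \<Longrightarrow> Ck_on k U (\<lambda>x. f x - g x)"
  using Ck_on_add[of U k f "\<lambda>x. - g x"] Ck_on_uminus[of U k g] by simp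

text \<open>Each term of the product rule pairs one differentiated factor with one undifferentiated
  factor. The latter is lowered to order \<open>k\<close> by \<open>Ck_on_SucD\<close>, and the
  induction has to range over all \<open>f\<close> and \<open>g\<close>.\<close>

lemma Ck_on_bounded_bilinear:
  assumes "open U" "bounded_bilinear h" "Ck_on k U f" "Ck_on k U g"
  shows "Ck_on k U (\<lambda>x. h (f x) (g x))"
  using assms(3,4)
proof (induction k arbitrary: f g)
  case 0
  then show ?case using assms(2) by (simp add: bounded_bilinear.continuous_on)
next
  case (Suc k)
  show ?case
    by (rule Ck_on_SucI[OF assms(1) bounded_bilinear.FDERIV[OF assms(2)]])
       (auto intro!: Ck_on_add[OF assms(1)] Suc.IH Suc.prems[THEN Ck_on_SucD]
         intro: Ck_on_SucE[OF Suc.prems(1)] Ck_on_SucE[OF Suc.prems(2)])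
qed

lemma Ck_on_mult:
  fixes f g :: "'a::euclidean_space \<Rightarrow> real"
  shows "open U \<Longrightarrow> Ck_on k U f \<Longrightarrow> Ck_on k U g \<Longrightarrow> Ck_on k U (\<lambda>x. f x * g x)"
  by (rule Ck_on_bounded_bilinear[OF _ bounded_bilinear_mult])

lemma Ck_on_Pair:
  assumes "open U" "Ck_on k U f" "Ck_on k U g"
  shows "Ck_on k U (\<lambda>x. (f x, g x))"
proof -
  \<comment> \<open>Writing the pair as a sum of two linear embeddings reduces it to the linear and
    additive rules.\<close>
  have "Ck_on k U (\<lambda>x. (f x, 0) + (0, g x))"
    using assms
    by (intro Ck_on_add Ck_on_bounded_linear_compose[of U "\<lambda>y. (y, 0)"]
        Ck_on_bounded_linear_compose[of U "\<lambda>y. (0, y)"] bounded_linear_intros)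
  then show ?thesis by simp
qed

lemma Ck_on_sum:
  assumes "open U" "\<And>i. i \<in> I \<Longrightarrow> Ck_on k U (f i)"
  shows "Ck_on k U (\<lambda>x. \<Sum>i\<in>I. f i x)"
  using assms(2)
  by (induction I rule: infinite_finite_induct)
     (simp_all add: Ck_on_const Ck_on_add assms(1))

lemma Ck_on_vec_nth:
  "open U \<Longrightarrow> Ck_on k U f \<Longrightarrow> Ck_on k U (\<lambda>x. f x $ i)"
  by (rule Ck_on_bounded_linear_compose[OF _ bounded_linear_vec_nth])

lemma bounded_linear_axis: "bounded_linear (axis i :: 'b::euclidean_space \<Rightarrow> 'b ^ 'n)"
  unfolding linear_conv_bounded_linear[symmetric]
  by (rule linearI) (auto simp: vec_eq_iff axis_def)

text \<open>A vector is the sum of its coordinates embedded along the linear maps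
  \<open>axis i\<close>. Matrices are handled by applying this to rows and then to entries.\<close>

lemma Ck_on_vecI:
  fixes f :: "'a::euclidean_space \<Rightarrow> 'b::euclidean_space ^ 'n"
  assumes "open U" "\<And>i. Ck_on k U (\<lambda>x. f x $ i)"
  shows "Ck_on k U f"
proof -
  have "Ck_on k U (\<lambda>x. \<Sum>i\<in>UNIV. axis i (f x $ i))"
    using assms by (intro Ck_on_sum Ck_on_bounded_linear_compose[OF _ bounded_linear_axis])
  moreover have "(\<Sum>i\<in>UNIV. axis i (f x $ i)) = f x" for x
    by (simp add: vec_eq_iff axis_def)
  ultimately show ?thesis by simp
qed

lemma Ck_on_matrix_mult:
  fixes f :: "'a::euclidean_space \<Rightarrow> real ^ 'm ^ 'n" and g :: "'a \<Rightarrow> real ^ 'p ^ 'm"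
  assumes "open U" "Ck_on k U f" "Ck_on k U g"
  shows "Ck_on k U (\<lambda>x. f x ** g x)"
  by (intro Ck_on_vecI[OF assms(1)])
     (simp add: matrix_matrix_mult_def Ck_on_sum Ck_on_mult Ck_on_vec_nth assms)

section \<open>Smoothness of the action\<close>

text \<open>Outside \<open>se3\<close> the value of \<open>vee\<close> is unspecified; this linear
  formula, reading one entry of each skew pair, is smooth on all matrices.\<close>

definition vee_ext :: "real^4^4 \<Rightarrow> real^6" where
  "vee_ext \<eta> = vector [\<eta>$3$2, \<eta>$1$3, \<eta>$2$1, \<eta>$1$4, \<eta>$2$4, \<eta>$3$4]"

lemma vee_ext_wedge: "vee_ext (wedge u) = u"
  by (simp add: vee_ext_def wedge_def wedge3_def Let_def vec_eq_iff forall_6)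

lemma vee_ext_eq: "\<eta> \<in> se3 \<Longrightarrow> vee_ext \<eta> = vee \<eta>"
  by (auto simp: se3_def vee_ext_wedge)

text \<open>
  On \<open>SE23\<close> this is the inverse of \<open>hg_block\<close>, since \<open>(A, a)\<inverse> = (A\<^sup>T, - A\<^sup>T a)\<close>.
\<close>

definition hg_block_inv :: "real^5^5 \<Rightarrow> real^4^4" where
  "hg_block_inv D = vector
     [vector [D$1$1, D$2$1, D$3$1, - (D$1$1 * D$1$4 + D$2$1 * D$2$4 + D$3$1 * D$3$4)],
      vector [D$1$2, D$2$2, D$3$2, - (D$1$2 * D$1$4 + D$2$2 * D$2$4 + D$3$2 * D$3$4)],
      vector [D$1$3, D$2$3, D$3$3, - (D$1$3 * D$1$4 + D$2$3 * D$2$4 + D$3$3 * D$3$4)],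
      vector [0, 0, 0, 1]]"

lemma hg_block_inv_eq:
  assumes "D \<in> SE23"
  shows "hg_block_inv D = matrix_inv (hg_block D)"
proof -
  obtain A a b where D: "D = se23_mat A a b" "A \<in> SO3"
    using assms by (auto simp: SE23_def)
  show ?thesis
    unfolding D(1) hg_block_se23_mat matrix_inv_hg_mat[OF D(2)]
    by (simp add: vec_eq_iff forall_4 hg_block_inv_def se23_mat_def hg_mat_def
        matrix_vector_mult_def transpose_def sum_3 del: transpose_matrix_vector)
qed

text \<open>Conjugation by the inverse of B ends with B itself, hence the right factor
  \<open>hg_block D\<close>.\<close>

definition phi_ext :: "((real^5^5) \<times> (real^4^4)) \<times> ((real^5^5) \<times> (real^6)) \<Rightarrow>
    (real^5^5) \<times> (real^6)" where
  "phi_ext = (\<lambda>((D, \<delta>), (T, b)).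
     (T ** D, vee_ext (hg_block_inv D ** wedge (b - vee_ext \<delta>) ** hg_block D)))"

lemma matrix_inv_matrix_inv_HG3: "B \<in> HG3 \<Longrightarrow> matrix_inv (matrix_inv B) = B"
  by (rule matrix_inv_eqI) (rule HG3_left_inv)

lemma phi_ext_eq:
  assumes "X \<in> carrier G_SD"
  shows "phi_ext (X, \<xi>) = phi_SD X \<xi>"
proof -
  obtain D \<delta> T b where X: "X = (D, \<delta>)" "D \<in> SE23" "\<delta> \<in> se3" and \<xi>: "\<xi> = (T, b)"
    using assms by (cases X; cases \<xi>) (auto simp: G_SD_def)
  have B: "hg_block D \<in> HG3"
    using X(2) by (rule hg_block_HG3)
  \<comment> \<open>This membership licenses replacing the outer \<open>vee\<close> by
    \<open>vee_ext\<close>.\<close>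
  have "Ad (matrix_inv (hg_block D)) (wedge (b - vee \<delta>)) \<in> se3"
    using B by (intro Ad_se3 HG3_matrix_inv) (auto simp: se3_def)
  then show ?thesis
    using X B by (simp add: \<xi> phi_ext_def phi_SD_def Ad_vee_def hg_block_inv_eq
        flip: vee_ext_eq) (simp add: Ad_def matrix_inv_matrix_inv_HG3)
qed

section \<open>Regularity of the extension\<close>

lemmas Ck_on_intros = Ck_on_const Ck_on_add Ck_on_uminus Ck_on_diff Ck_on_mult Ck_on_vec_nth

lemma Ck_on_vee_ext:
  assumes "open U" "Ck_on k U f"
  shows "Ck_on k U (\<lambda>x. vee_ext (f x))"
proof (rule Ck_on_vecI[OF assms(1)])
  have "\<forall>i. Ck_on k U (\<lambda>x. vee_ext (f x) $ i)"
    unfolding forall_6 vee_ext_def by (simp add: assms Ck_on_intros)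
  then show "Ck_on k U (\<lambda>x. vee_ext (f x) $ i)" for i ..
qed

text \<open>The quantifiers are kept in the object logic so that \<open>forall_4\<close> can split
  the goal into sixteen entries.\<close>

lemma Ck_on_mat4I:
  fixes f :: "'a::euclidean_space \<Rightarrow> real^4^4"
  assumes "open U" "\<forall>i j. Ck_on k U (\<lambda>x. f x $ i $ j)"
  shows "Ck_on k U f"
  using assms by (intro Ck_on_vecI) auto

lemma Ck_on_wedge:
  assumes "open U" "Ck_on k U f"
  shows "Ck_on k U (\<lambda>x. wedge (f x))"
  by (rule Ck_on_mat4I[OF assms(1)])
     (simp add: forall_4 wedge_def wedge3_def Let_def assms Ck_on_intros)

lemma Ck_on_hg_block:
  assumes "open U" "Ck_on k U f"
  shows "Ck_on k U (\<lambda>x. hg_block (f x))"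
  by (rule Ck_on_mat4I[OF assms(1)]) (simp add: forall_4 hg_block_def assms Ck_on_intros)

lemma Ck_on_hg_block_inv:
  assumes "open U" "Ck_on k U f"
  shows "Ck_on k U (\<lambda>x. hg_block_inv (f x))"
  by (rule Ck_on_mat4I[OF assms(1)])
     (simp add: forall_4 hg_block_inv_def assms Ck_on_intros del: minus_add_distrib)

lemma Ck_on_phi_ext: "Ck_on k UNIV phi_ext"
proof -
  have [simp]: "Ck_on k UNIV (\<lambda>z. fst (fst z))" "Ck_on k UNIV (\<lambda>z. snd (fst z))"
    "Ck_on k UNIV (\<lambda>z. fst (snd z))" "Ck_on k UNIV (\<lambda>z. snd (snd z))"
    by (intro Ck_on_bounded_linear open_UNIV bounded_linear_intros)+
  have "Ck_on k UNIV (\<lambda>z. (fst (snd z) ** fst (fst z),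
      vee_ext (hg_block_inv (fst (fst z)) ** wedge (snd (snd z) - vee_ext (snd (fst z)))
        ** hg_block (fst (fst z)))))"
    by (intro Ck_on_Pair Ck_on_matrix_mult Ck_on_vee_ext Ck_on_wedge Ck_on_hg_block
        Ck_on_hg_block_inv Ck_on_diff open_UNIV) simp_all
  then show ?thesis
    by (simp add: phi_ext_def case_prod_beta')
qed

lemma phi_SD_closed: "X \<in> carrier G_SD \<Longrightarrow> \<xi> \<in> M_SD \<Longrightarrow> phi_SD X \<xi> \<in> M_SD"
  by (auto simp: G_SD_def M_SD_def phi_SD_def SE23_mult)

lemma smooth_map_phi_SD:
  "smooth_map (carrier G_SD \<times> M_SD) M_SD (\<lambda>(X, \<xi>). phi_SD X \<xi>)"
  unfolding smooth_map_def
proof (intro conjI ballI)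
  show "(\<lambda>(X, \<xi>). phi_SD X \<xi>) \<in> carrier G_SD \<times> M_SD \<rightarrow> M_SD"
    by (auto simp: phi_SD_closed)
  \<comment> \<open>One global extension serves at every point, with \<open>UNIV\<close> as the
    neighbourhood.\<close>
  have "\<forall>y\<in>carrier G_SD \<times> M_SD \<inter> UNIV. phi_ext y = (case y of (X, \<xi>) \<Rightarrow> phi_SD X \<xi>)"
    by (auto simp: phi_ext_eq)
  then show "\<exists>U g. open U \<and> z \<in> U \<and> (\<forall>k. Ck_on k U g) \<and>
      (\<forall>y\<in>carrier G_SD \<times> M_SD \<inter> U. g y = (case y of (X, \<xi>) \<Rightarrow> phi_SD X \<xi>))" for z
    using Ck_on_phi_ext by blast
qed

section \<open>The action law and transitivity\<close>

lemma wedge_diff: "wedge (u - v) = wedge u - wedge v"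
  by (simp add: vec_eq_iff forall_4 wedge_def wedge3_def Let_def)

lemma Ad_diff: "Ad B (\<eta> - \<theta>) = Ad B \<eta> - Ad B \<theta>"
  using Ad_add[of B \<eta> "- \<theta>"] by (simp add: Ad_uminus)

lemma wedge_in_se3: "wedge u \<in> se3"
  by (simp add: se3_def)

lemma wedge_Ad_vee: "B \<in> HG3 \<Longrightarrow> wedge (Ad_vee B u) = Ad B (wedge u)"
  by (simp add: Ad_vee_def wedge_vee Ad_se3 wedge_in_se3)

lemma Ad_matrix_inv_cancel: "B \<in> HG3 \<Longrightarrow> Ad (matrix_inv B) (Ad B \<eta>) = \<eta>"
  by (simp add: Ad_mult[symmetric] HG3_matrix_inv HG3_left_inv Ad_mat_1)

text \<open>By linearity of \<open>wedge\<close>, the shift by \<delta> can be carried out inside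
  \<open>se3\<close>, where the rules for \<open>Ad\<close> apply.\<close>

lemma phi_SD_eq:
  assumes "D \<in> SE23" "\<delta> \<in> se3"
  shows "phi_SD (D, \<delta>) (T, b) =
    (T ** D, vee (Ad (matrix_inv (hg_block D)) (wedge b - \<delta>)))"
  by (simp add: phi_SD_def Ad_vee_def wedge_diff wedge_vee assms)

lemma phi_SD_one: "phi_SD \<one>\<^bsub>G_SD\<^esub> \<xi> = \<xi>"
  by (cases \<xi>) (simp add: G_SD_def phi_SD_eq SE23_1 se3_0 hg_block_1 matrix_inv_eqI Ad_mat_1)

lemma phi_SD_mult:
  assumes "X \<in> carrier G_SD" "Y \<in> carrier G_SD"
  shows "phi_SD X (phi_SD Y \<xi>) = phi_SD (Y \<otimes>\<^bsub>G_SD\<^esub> X) \<xi>"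
proof -
  obtain D \<delta> E \<epsilon> T b where X: "X = (D, \<delta>)" "D \<in> SE23" "\<delta> \<in> se3"
    and Y: "Y = (E, \<epsilon>)" "E \<in> SE23" "\<epsilon> \<in> se3" and \<xi>: "\<xi> = (T, b)"
    using assms by (cases X; cases Y; cases \<xi>) (auto simp: G_SD_def)
  let ?B = "hg_block D" and ?C = "hg_block E"
  have HG: "?B \<in> HG3" "?C \<in> HG3"
    using X(2) Y(2) by (simp_all add: hg_block_HG3)
  \<comment> \<open>Needed so that \<open>wedge\<close> undoes the \<open>vee\<close> of the inner
    value when X acts on it.\<close>
  have "wedge b - \<epsilon> \<in> se3"
    using se3_add[OF wedge_in_se3 se3_uminus[OF Y(3)]] by simp
  then have "Ad (matrix_inv ?C) (wedge b - \<epsilon>) \<in> se3"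
    using HG by (simp add: Ad_se3 HG3_matrix_inv)
  then have "phi_SD X (phi_SD Y \<xi>) =
      (T ** E ** D, vee (Ad (matrix_inv ?B) (Ad (matrix_inv ?C) (wedge b - \<epsilon>) - \<delta>)))"
    by (simp add: X Y \<xi> phi_SD_eq wedge_vee)
  \<comment> \<open>Writing \<delta> as \<open>Ad (matrix_inv ?C) (Ad ?C \<delta>)\<close> merges
    both shifts into the second component of the product of Y and X.\<close>
  also have "Ad (matrix_inv ?C) (wedge b - \<epsilon>) - \<delta> =
      Ad (matrix_inv ?C) (wedge b - (\<epsilon> + Ad ?C \<delta>))"
    using HG by (simp add: Ad_diff Ad_add Ad_matrix_inv_cancel)
  also have "(T ** E ** D, vee (Ad (matrix_inv ?B) \<dots>)) = phi_SD (Y \<otimes>\<^bsub>G_SD\<^esub> X) \<xi>"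
    using X Y HG
    by (simp add: \<xi> G_SD_def phi_SD_eq SE23_mult se3_add Ad_se3 hg_block_mult
        HG3_matrix_inv_mult Ad_mult HG3_matrix_inv matrix_mul_assoc)
  finally show ?thesis .
qed

lemma transitive_phi_SD: "transitive_action G_SD M_SD phi_SD"
  unfolding transitive_action_def
proof (intro ballI)
  fix \<xi>\<^sub>1 \<xi>\<^sub>2
  assume "\<xi>\<^sub>1 \<in> M_SD" "\<xi>\<^sub>2 \<in> M_SD"
  then obtain S b T c where \<xi>: "\<xi>\<^sub>1 = (S, b)" "\<xi>\<^sub>2 = (T, c)" and ST: "S \<in> SE23" "T \<in> SE23"
    by (auto simp: M_SD_def)
  \<comment> \<open>The first component forces \<open>S ** D = T\<close>; then \<delta> is found by
    solving \<open>Ad (matrix_inv (hg_block D)) (wedge b - \<delta>) = wedge c\<close>.\<close>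
  define D where "D = matrix_inv S ** T"
  define \<delta> where "\<delta> = wedge b - Ad (hg_block D) (wedge c)"
  have D: "D \<in> SE23"
    using ST by (simp add: D_def SE23_mult SE23_matrix_inv)
  then have \<delta>: "\<delta> \<in> se3"
    using se3_add[OF wedge_in_se3 se3_uminus[OF Ad_se3[OF hg_block_HG3 wedge_in_se3]]]
    by (simp add: \<delta>_def)
  have "S ** D = T"
    using ST by (simp add: D_def matrix_mul_assoc SE23_right_inv)
  then have "phi_SD (D, \<delta>) \<xi>\<^sub>1 = \<xi>\<^sub>2"
    using D \<delta> by (simp add: \<xi> phi_SD_eq) (simp add: \<delta>_def Ad_matrix_inv_cancel hg_block_HG3)
  moreover have "(D, \<delta>) \<in> carrier G_SD"
    using D \<delta> by (simp add: G_SD_def)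
  ultimately show "\<exists>Z\<in>carrier G_SD. phi_SD Z \<xi>\<^sub>1 = \<xi>\<^sub>2" by blast
qed

theorem lemma5p7p1:
  shows "right_group_action G_SD M_SD phi_SD \<and> transitive_action G_SD M_SD phi_SD"
  using group_G_SD smooth_map_phi_SD phi_SD_one phi_SD_mult transitive_phi_SD
  by (simp add: right_group_action_def)

end
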